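(* Let $d\ge 1$ be an integer, let $\sigma^2>0$, $\kappa>0$, and let $\alpha>\frac d2$ be a non-integer with integer part $[\alpha]$. Let $a_0=1$ and $a_k=\frac{\alpha(\alpha-1)\cdots(\alpha-k+1)}{k!}$ for $k\ge1$. Let $K_J=[\alpha]+2J+1$ for $J\in\mathbb{N}$. Then the approximations $$C_X^{K_J}(x,y)=\frac{\sigma^2}{(2\pi)^d}\int_{\mathbb{R}^d}\frac{\exp\left(-i(x-y)\cdot\xi\right)}{\sum_{k=0}^{K_J}a_k\,\kappa^{2(\alpha-k)}|\xi|^{2k}}\,d\xi$$ converge uniformly in $x,y\in\mathbb{R}^d$ to $$C_X(x,y)=\frac{\sigma^2}{(2\pi)^d}\int_{|\xi|\le\kappa}\frac{\exp\left(-i(x-y)\cdot\xi\right)}{(\kappa^2+|\xi|^2)^{\alpha}}\,d\xi$$ as $J\to\infty$.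
   Context: The numbers $a_k$ are the generalized binomial coefficients, so that $(\kappa^2+t^2)^\alpha=\sum_{k=0}^\infty a_k\kappa^{2(\alpha-k)}t^{2k}$ for $|t|\le\kappa$. The integral defining $C_X^{K_J}$ is over the whole of $\mathbb{R}^d$ (no restriction to $|\xi|\le\kappa$). *)

theory Defs
  imports "HOL-Analysis.Analysis"
begin

text \<open>
  The dimension is \<^term>\<open>CARD('n)\<close>, and \<open>\<sigma>\<close> enters only through \<open>\<sigma>\<^sup>2\<close>.
  Integrals are Lebesgue integrals of complex-valued functions on \<open>real ^ 'n\<close>.
  The coefficients \<open>a\<^sub>k = \<alpha> (\<alpha> - 1) \<cdots> (\<alpha> - k + 1) / k!\<close>, with \<open>a\<^sub>0 = 1\<close>, are the
  library's generalised binomial coefficients \<open>\<alpha> gchoose k\<close>.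
\<close>

definition cov_symbol :: "real \<Rightarrow> real \<Rightarrow> nat \<Rightarrow> real ^ 'n \<Rightarrow> real"
  where "cov_symbol \<kappa> \<alpha> K \<xi> =
    (\<Sum>k=0..K. (\<alpha> gchoose k) * \<kappa> powr (2 * (\<alpha> - real k)) * norm \<xi> ^ (2 * k))"

definition cov_approx ::
    "real \<Rightarrow> real \<Rightarrow> real \<Rightarrow> nat \<Rightarrow> real ^ 'n \<Rightarrow> real ^ 'n \<Rightarrow> complex"
  where "cov_approx \<sigma> \<kappa> \<alpha> K x y =
    complex_of_real (\<sigma>\<^sup>2 / (2 * pi) ^ CARD('n)) *
      (LINT \<xi>|lborel. exp (- (\<i> * complex_of_real ((x - y) \<bullet> \<xi>))) /
                      complex_of_real (cov_symbol \<kappa> \<alpha> K \<xi>))"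

definition cov_limit :: "real \<Rightarrow> real \<Rightarrow> real \<Rightarrow> real ^ 'n \<Rightarrow> real ^ 'n \<Rightarrow> complex"
  where "cov_limit \<sigma> \<kappa> \<alpha> x y =
    complex_of_real (\<sigma>\<^sup>2 / (2 * pi) ^ CARD('n)) *
      (LINT \<xi>:cball 0 \<kappa>|lborel. exp (- (\<i> * complex_of_real ((x - y) \<bullet> \<xi>))) /
                      complex_of_real ((\<kappa>\<^sup>2 + (norm \<xi>)\<^sup>2) powr \<alpha>))"

definition trunc_order :: "real \<Rightarrow> nat \<Rightarrow> nat"
  where "trunc_order \<alpha> J = nat \<lfloor>\<alpha>\<rfloor> + 2 * J + 1"

end

theory Submission
  imports Defs
begin

text \<open>
  Put \<open>u = \<bar>\<xi>\<bar>\<^sup>2 / \<kappa>\<^sup>2\<close>. Up to the factor \<open>\<kappa>\<^sup>2\<^sup>\<alpha>\<close>, the denominator of the approximation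
  is the \<open>K\<close>-th partial sum \<open>S\<^sub>K(u)\<close> of the binomial series of \<open>(1 + u)\<^sup>\<alpha>\<close>. The phase factor has
  modulus one, so the error is bounded, uniformly in \<open>x\<close> and \<open>y\<close>, by a multiple of the \<open>L\<^sup>1\<close>
  distance between the reciprocal of the denominator and the limit density cut off to the ball;
  this distance is shown to vanish by dominated convergence.

  For \<open>u < 1\<close> the binomial series converges, which gives the limit density inside the ball. For
  the rest, \<open>S\<^sub>K\<close> is controlled by one differential equation,
  \<open>(1 + u) S\<^sub>K'(u) = \<alpha> S\<^sub>K(u) - (K + 1) a\<^sub>K\<^sub>+\<^sub>1 u\<^sup>K\<close>
  (\<open>binomial_partial_sum_ode\<close>), which is the equation of the binomial function with one error
  term. The truncation orders are chosen such that \<open>a\<^sub>K\<^sub>+\<^sub>1 < 0\<close>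
  (\<open>gbinomial_trunc_order_signs\<close>), so the error term pushes \<open>S\<^sub>K\<close> up. This has two consequences.

  \<^item> For every \<open>u \<ge> 0\<close>, also beyond the radius of convergence, \<open>S\<^sub>K(u) \<ge> (1 + u)\<^sup>\<alpha>\<close>
    (\<open>powr_le_binomial_partial_sum\<close>). Hence all integrands are dominated by
    \<open>(\<kappa>\<^sup>2 + \<bar>\<xi>\<bar>\<^sup>2)\<^sup>-\<^sup>\<alpha>\<close>, which is integrable because \<open>\<alpha> > d/2\<close>
    (\<open>integrable_inverse_quadratic_norm_powr\<close>).

  \<^item> For \<open>u > 1\<close> the error term grows geometrically and forces \<open>S\<^sub>K(u)\<close> to infinity
    (\<open>binomial_partial_sum_at_top\<close>), so outside the ball the integrands tend to \<open>0\<close>.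

  The remaining sphere \<open>u = 1\<close> is a null set.
\<close>

section \<open>Generalised binomial coefficients\<close>

lemma gbinomial_Suc_ratio:
  fixes a :: real
  shows "real (Suc k) * (a gchoose Suc k) = (a - real k) * (a gchoose k)"
  using gbinomial_mult_1[of a k] by (simp add: left_diff_distrib)

lemma gbinomial_pos:
  fixes a :: real
  assumes "real k < a + 1"
  shows "a gchoose k > 0"
  using assms by (auto simp: gbinomial_prod_rev intro!: prod_pos divide_pos_pos)

text \<open>
  The coefficients are positive up to index \<open>\<lfloor>\<alpha>\<rfloor> + 1\<close>, because all factors \<open>\<alpha> - i\<close> with
  \<open>i \<le> \<lfloor>\<alpha>\<rfloor>\<close> are positive; from there on every new factor is negative and the signs alternate.
  The truncation orders pick every second index of this alternating tail, so the first omitted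
  coefficient is always negative.
\<close>

lemma gbinomial_trunc_order_signs:
  assumes "\<alpha> > 0" "\<alpha> \<notin> \<int>"
  shows "\<alpha> gchoose (trunc_order \<alpha> J) > 0 \<and> \<alpha> gchoose (Suc (trunc_order \<alpha> J)) < 0"
proof -
  have fl: "real (nat \<lfloor>\<alpha>\<rfloor>) < \<alpha>" "\<alpha> < real (nat \<lfloor>\<alpha>\<rfloor>) + 1"
  proof -
    have "real (nat \<lfloor>\<alpha>\<rfloor>) = of_int \<lfloor>\<alpha>\<rfloor>" using assms(1) by simp
    moreover have "of_int \<lfloor>\<alpha>\<rfloor> \<noteq> \<alpha>" using assms(2) by (metis Ints_of_int)
    ultimately show "real (nat \<lfloor>\<alpha>\<rfloor>) < \<alpha>" "\<alpha> < real (nat \<lfloor>\<alpha>\<rfloor>) + 1"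
      by linarith+
  qed
  have step: "(\<alpha> gchoose Suc k) * (\<alpha> gchoose k) < 0" if "\<alpha> < real k" "\<alpha> gchoose k \<noteq> 0" for k
  proof -
    have "real (Suc k) * ((\<alpha> gchoose Suc k) * (\<alpha> gchoose k)) = (\<alpha> - real k) * (\<alpha> gchoose k)\<^sup>2"
      using gbinomial_Suc_ratio[of k \<alpha>] by (simp add: power2_eq_square mult.assoc[symmetric])
    also have "\<dots> < 0" using that by (simp add: mult_neg_pos)
    finally show ?thesis by (simp add: mult_less_0_iff)
  qed
  have neg: "\<alpha> gchoose (Suc (trunc_order \<alpha> J)) < 0" if "\<alpha> gchoose (trunc_order \<alpha> J) > 0" for J
  proof -
    have "\<alpha> < real (trunc_order \<alpha> J)" using fl unfolding trunc_order_def by linarith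
    from step[OF this] that show ?thesis by (auto simp: mult_less_0_iff)
  qed
  have pos: "\<alpha> gchoose (trunc_order \<alpha> J) > 0" for J
  proof (induction J)
    case 0
    show ?case by (rule gbinomial_pos) (use fl in \<open>simp add: trunc_order_def\<close>)
  next
    case (Suc J)
    have "\<alpha> < real (Suc (trunc_order \<alpha> J))" using fl unfolding trunc_order_def by linarith
    from step[OF this] neg[OF Suc] show ?case
      by (auto simp: mult_less_0_iff trunc_order_def)
  qed
  from pos neg show ?thesis by blast
qed

text \<open>
  The ratio of consecutive terms is \<open>v \<bar>\<alpha> - k - 1\<bar> / (k + 1)\<close>, which tends to \<open>v > 1\<close>; no term
  vanishes since \<open>\<alpha>\<close> is not an integer. Divergence is read off from the ratio test for the
  reciprocals, whose series converges and whose terms therefore tend to \<open>0\<close>.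
\<close>

lemma gbinomial_abs_power_at_top:
  fixes \<alpha> v :: real
  assumes "\<alpha> \<notin> \<int>" "1 < v"
  shows "filterlim (\<lambda>k. real (Suc k) * \<bar>\<alpha> gchoose Suc k\<bar> * v ^ k) at_top sequentially"
proof -
  define c where "c k = real (Suc k) * \<bar>\<alpha> gchoose Suc k\<bar> * v ^ k" for k
  have nz: "\<alpha> gchoose k \<noteq> 0" for k
    using assms(1) by (auto simp: gbinomial_prod_rev)
  have cpos: "c k > 0" for k using nz[of "Suc k"] assms by (simp add: c_def)
  \<comment> \<open>Any number strictly between \<open>1\<close> and the limit \<open>v\<close> of the ratios would do.\<close>
  define w where "w = (1 + v) / 2"
  have w: "1 < w" "w < v" using assms by (auto simp: w_def)
  have cSuc: "c (Suc k) = v * \<bar>\<alpha> - real (Suc k)\<bar> / real (Suc k) * c k" for k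
  proof -
    have "real (Suc (Suc k)) * \<bar>\<alpha> gchoose Suc (Suc k)\<bar> = \<bar>\<alpha> - real (Suc k)\<bar> * \<bar>\<alpha> gchoose Suc k\<bar>"
      using gbinomial_Suc_ratio[of "Suc k" \<alpha>] by (metis abs_mult abs_of_nat)
    thus ?thesis by (simp add: c_def)
  qed
  have "(\<lambda>k. v * \<bar>\<alpha> * inverse (real (Suc k)) - 1\<bar>) \<longlonglongrightarrow> v * \<bar>\<alpha> * 0 - 1\<bar>"
    by (intro tendsto_intros LIMSEQ_inverse_real_of_nat)
  moreover have "v * \<bar>\<alpha> * inverse (real (Suc k)) - 1\<bar> = v * \<bar>\<alpha> - real (Suc k)\<bar> / real (Suc k)" for k
  proof -
    have "\<alpha> * inverse (real (Suc k)) - 1 = (\<alpha> - real (Suc k)) / real (Suc k)"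
      by (simp add: field_simps)
    thus ?thesis by (simp add: abs_divide)
  qed
  ultimately have "(\<lambda>k. v * \<bar>\<alpha> - real (Suc k)\<bar> / real (Suc k)) \<longlonglongrightarrow> v"
    by simp
  hence "eventually (\<lambda>k. v * \<bar>\<alpha> - real (Suc k)\<bar> / real (Suc k) > w) sequentially"
    using w by (intro order_tendstoD)
  then obtain N where N: "\<And>k. k \<ge> N \<Longrightarrow> v * \<bar>\<alpha> - real (Suc k)\<bar> / real (Suc k) > w"
    by (auto simp: eventually_at_top_linorder)
  have "summable (\<lambda>k. inverse (c k))"
  proof (rule summable_ratio_test[of "inverse w" N])
    show "inverse w < 1" using w by (simp add: field_simps)
    fix k assume "k \<ge> N"
    have "w * c k \<le> c (Suc k)"
      unfolding cSuc using N[OF \<open>k \<ge> N\<close>] cpos[of k] by (intro mult_right_mono) auto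
    hence "inverse (c (Suc k)) \<le> inverse (w * c k)"
      using w cpos[of k] by (intro le_imp_inverse_le) auto
    thus "norm (inverse (c (Suc k))) \<le> inverse w * norm (inverse (c k))"
      using cpos[of k] cpos[of "Suc k"] by simp
  qed
  hence "(\<lambda>k. inverse (c k)) \<longlonglongrightarrow> 0" by (rule summable_LIMSEQ_zero)
  hence "filterlim (\<lambda>k. inverse (inverse (c k))) at_top sequentially"
    by (rule filterlim_inverse_at_top) (use cpos in auto)
  thus ?thesis by (simp add: c_def)
qed

section \<open>Partial sums of the binomial series\<close>

definition binomial_partial_sum :: "real \<Rightarrow> nat \<Rightarrow> real \<Rightarrow> real"
  where "binomial_partial_sum \<alpha> K u = (\<Sum>k\<le>K. (\<alpha> gchoose k) * u ^ k)"

text \<open>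
  Differentiating the sum and multiplying by \<open>1 + u\<close> gives, below degree \<open>K\<close>, the coefficients
  \<open>(k + 1) a\<^sub>k\<^sub>+\<^sub>1 + k a\<^sub>k = \<alpha> a\<^sub>k\<close>. In degree \<open>K\<close> the term \<open>(K + 1) a\<^sub>K\<^sub>+\<^sub>1\<close> is missing, and it is the
  whole defect from the equation \<open>(1 + u) y' = \<alpha> y\<close> of the binomial function.
\<close>

lemma binomial_partial_sum_ode:
  "\<exists>D. (binomial_partial_sum \<alpha> K has_real_derivative D) (at u) \<and>
     (1 + u) * D = \<alpha> * binomial_partial_sum \<alpha> K u - real (Suc K) * (\<alpha> gchoose Suc K) * u ^ K"
proof (induction K)
  case 0
  show ?case
    by (rule exI[of _ 0]) (simp add: binomial_partial_sum_def)
next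
  case (Suc K)
  then obtain D where D: "(binomial_partial_sum \<alpha> K has_real_derivative D) (at u)"
    "(1 + u) * D = \<alpha> * binomial_partial_sum \<alpha> K u - real (Suc K) * (\<alpha> gchoose Suc K) * u ^ K" by blast
  have eq: "binomial_partial_sum \<alpha> (Suc K) =
      (\<lambda>u. binomial_partial_sum \<alpha> K u + (\<alpha> gchoose Suc K) * u ^ Suc K)"
    by (simp add: binomial_partial_sum_def fun_eq_iff)
  let ?b = "\<alpha> gchoose Suc K"
  have "(binomial_partial_sum \<alpha> (Suc K) has_real_derivative D + ?b * (real (Suc K) * u ^ K)) (at u)"
    unfolding eq using DERIV_add[OF D(1) DERIV_cmult[OF DERIV_pow[of "Suc K" u UNIV]]]
    by simp
  moreover have "(1 + u) * (D + ?b * (real (Suc K) * u ^ K)) =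
      \<alpha> * binomial_partial_sum \<alpha> (Suc K) u - real (Suc (Suc K)) * (\<alpha> gchoose Suc (Suc K)) * u ^ Suc K"
  proof -
    have rec: "real (Suc (Suc K)) * (\<alpha> gchoose Suc (Suc K)) = (\<alpha> - real (Suc K)) * ?b"
      by (rule gbinomial_Suc_ratio)
    show ?thesis unfolding rec unfolding distrib_left D(2) eq
      by (simp add: algebra_simps)
  qed
  ultimately show ?case by blast
qed

text \<open>
  The quotient of the partial sum by \<open>(1 + u)\<^sup>\<alpha>\<close> equals \<open>1\<close> at \<open>0\<close> and, by the
  differential equation, has derivative \<open>- (K + 1) a\<^sub>K\<^sub>+\<^sub>1 u\<^sup>K\<close> times a power of \<open>1 + u\<close>, which is
  nonnegative; the quotient is therefore nondecreasing.
\<close>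

lemma powr_le_binomial_partial_sum:
  assumes neg: "\<alpha> gchoose Suc K \<le> 0" and "0 \<le> u"
  shows "(1 + u) powr \<alpha> \<le> binomial_partial_sum \<alpha> K u"
proof -
  let ?h = "\<lambda>u. binomial_partial_sum \<alpha> K u * (1 + u) powr (-\<alpha>)"
  have "?h 0 \<le> ?h u"
  proof (rule DERIV_nonneg_imp_nondecreasing[OF \<open>0 \<le> u\<close>])
    fix x :: real assume x: "0 \<le> x" "x \<le> u"
    obtain D where D: "(binomial_partial_sum \<alpha> K has_real_derivative D) (at x)"
      "(1 + x) * D = \<alpha> * binomial_partial_sum \<alpha> K x - real (Suc K) * (\<alpha> gchoose Suc K) * x ^ K"
      using binomial_partial_sum_ode by blast
    let ?h' = "D * (1 + x) powr (-\<alpha>) + binomial_partial_sum \<alpha> K x * (-\<alpha> * (1 + x) powr (-\<alpha> - 1))"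
    have "(?h has_real_derivative ?h') (at x)"
      using x by (auto intro!: derivative_eq_intros D(1))
    moreover have "?h' \<ge> 0"
    proof -
      have "(1 + x) powr (-\<alpha>) = (1 + x) * (1 + x) powr (-\<alpha> - 1)"
        using x by (simp add: powr_diff)
      hence "?h' = ((1 + x) * D - \<alpha> * binomial_partial_sum \<alpha> K x) * (1 + x) powr (-\<alpha> - 1)"
        by (simp add: algebra_simps)
      also have "\<dots> = - (real (Suc K) * (\<alpha> gchoose Suc K) * x ^ K * (1 + x) powr (-\<alpha> - 1))"
        unfolding D(2) by (simp add: algebra_simps)
      also have "\<dots> \<ge> 0"
        using neg x by (simp add: mult_nonpos_nonneg mult_nonneg_nonpos)
      finally show ?thesis .
    qed
    ultimately show "\<exists>y. (?h has_real_derivative y) (at x) \<and> 0 \<le> y" by blast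
  qed
  moreover have "?h 0 = 1" by (simp add: binomial_partial_sum_def sum.atMost_shift)
  ultimately have "1 \<le> binomial_partial_sum \<alpha> K u * (1 + u) powr (-\<alpha>)" by simp
  thus ?thesis using \<open>0 \<le> u\<close> by (simp add: powr_minus field_simps)
qed

text \<open>
  The previous bound does not depend on \<open>K\<close>, so it cannot show divergence. Here the error term
  of the differential equation is kept instead: since the partial sum is nonnegative by the
  previous bound, the error term bounds the derivative on \<open>[v, u]\<close> from below, and the mean
  value theorem turns this into growth of the partial sum itself.
\<close>

lemma binomial_partial_sum_lower_bound:
  assumes "0 \<le> \<alpha>" and neg: "\<alpha> gchoose Suc K \<le> 0" and "0 \<le> v" "v \<le> u"
  shows "(u - v) * (real (Suc K) * (- (\<alpha> gchoose Suc K)) * v ^ K)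
    \<le> (1 + u) * binomial_partial_sum \<alpha> K u"
proof (cases "v = u")
  case True
  have "0 \<le> binomial_partial_sum \<alpha> K u"
    using powr_le_binomial_partial_sum[OF neg, of u] assms by (meson order_trans powr_ge_zero)
  with True assms show ?thesis by simp
next
  case False
  hence "v < u" using assms by simp
  define c where "c = real (Suc K) * (- (\<alpha> gchoose Suc K))"
  have c: "c \<ge> 0" using neg by (auto simp: c_def intro: mult_nonneg_nonpos)
  define D where "D x = (\<alpha> * binomial_partial_sum \<alpha> K x + c * x ^ K) / (1 + x)" for x
  have der: "(binomial_partial_sum \<alpha> K has_real_derivative D x) (at x)" if "0 \<le> x" for x
  proof -
    obtain E where E: "(binomial_partial_sum \<alpha> K has_real_derivative E) (at x)"
      "(1 + x) * E = \<alpha> * binomial_partial_sum \<alpha> K x - real (Suc K) * (\<alpha> gchoose Suc K) * x ^ K"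
      using binomial_partial_sum_ode by blast
    from E(2) that have "E = D x" by (simp add: D_def c_def field_simps)
    with E(1) show ?thesis by simp
  qed
  obtain z where z: "v < z" "z < u" "binomial_partial_sum \<alpha> K u - binomial_partial_sum \<alpha> K v = (u - v) * D z"
    using MVT2[OF \<open>v < u\<close>, of "binomial_partial_sum \<alpha> K" D] der assms by force
  have nn: "0 \<le> binomial_partial_sum \<alpha> K x" if "0 \<le> x" for x
    using powr_le_binomial_partial_sum[OF neg that] by (meson order_trans powr_ge_zero)
  have "c * v ^ K \<le> (1 + u) * D z"
  proof -
    have "c * v ^ K \<le> c * z ^ K"
      using z assms c by (intro mult_left_mono power_mono) auto
    also have "\<dots> \<le> \<alpha> * binomial_partial_sum \<alpha> K z + c * z ^ K"
      using nn[of z] assms z by simp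
    also have "\<dots> = (1 + z) * D z"
      using z assms by (simp add: D_def)
    also have "\<dots> \<le> (1 + u) * D z"
      using z assms nn[of z] c by (intro mult_right_mono) (auto simp: D_def)
    finally show ?thesis .
  qed
  hence "(u - v) * (c * v ^ K) \<le> (u - v) * ((1 + u) * D z)"
    using \<open>v < u\<close> by (intro mult_left_mono) auto
  also have "\<dots> = (1 + u) * (binomial_partial_sum \<alpha> K u - binomial_partial_sum \<alpha> K v)"
    using z(3) by simp
  also have "\<dots> \<le> (1 + u) * binomial_partial_sum \<alpha> K u"
    using nn[of v] assms by (intro mult_left_mono) auto
  finally show ?thesis by (simp add: c_def)
qed

lemma filterlim_trunc_order: "filterlim (trunc_order \<alpha>) at_top sequentially"
  by (rule filterlim_subseq) (auto simp: strict_mono_def trunc_order_def)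

lemma binomial_partial_sum_tendsto_powr:
  assumes "0 \<le> u" "u < 1"
  shows "(\<lambda>J. binomial_partial_sum \<alpha> (trunc_order \<alpha> J) u) \<longlonglongrightarrow> (1 + u) powr \<alpha>"
proof -
  have "(\<lambda>K. binomial_partial_sum \<alpha> K u) \<longlonglongrightarrow> (1 + u) powr \<alpha>"
    using gen_binomial_real[of u \<alpha>] assms by (simp add: sums_def_le binomial_partial_sum_def)
  from filterlim_compose[OF this filterlim_trunc_order] show ?thesis .
qed

lemma binomial_partial_sum_at_top:
  assumes "\<alpha> > 0" "\<alpha> \<notin> \<int>" "1 < u"
  shows "filterlim (\<lambda>J. binomial_partial_sum \<alpha> (trunc_order \<alpha> J) u) at_top sequentially"
proof -
  \<comment> \<open>A point in \<open>(1, u)\<close>: the error term must already grow at \<open>v\<close>, and \<open>u - v\<close> must be positive.\<close>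
  define v where "v = (1 + u) / 2"
  have v: "1 < v" "v < u" using assms by (auto simp: v_def)
  let ?K = "trunc_order \<alpha>"
  let ?c = "\<lambda>k. real (Suc k) * \<bar>\<alpha> gchoose Suc k\<bar> * v ^ k"
  have "filterlim (\<lambda>J. ?c (?K J)) at_top sequentially"
    by (rule filterlim_compose[OF gbinomial_abs_power_at_top filterlim_trunc_order])
       (use assms v in auto)
  hence "filterlim (\<lambda>J. (u - v) / (1 + u) * ?c (?K J)) at_top sequentially"
    using v by (intro filterlim_tendsto_pos_mult_at_top[OF tendsto_const]) auto
  thus ?thesis
  proof (rule filterlim_at_top_mono, intro always_eventually allI)
    fix J
    have neg: "\<alpha> gchoose Suc (?K J) < 0"
      using gbinomial_trunc_order_signs assms by blast
    show "(u - v) / (1 + u) * ?c (?K J) \<le> binomial_partial_sum \<alpha> (?K J) u"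
      using binomial_partial_sum_lower_bound[of \<alpha> "?K J" v u] neg v assms
      by (simp add: field_simps)
  qed
qed

section \<open>Integrability of inverse powers of \<open>\<kappa>\<^sup>2 + \<bar>x\<bar>\<^sup>2\<close>\<close>

lemma integrable_powr_half_line:
  fixes a e :: real
  assumes "e < -1" "a > 0"
  shows "integrable lborel (\<lambda>x. indicator {a..} x * x powr e)"
proof -
  have "((\<lambda>x. x powr e) has_integral -(a powr (e+1)) / (e+1)) {a..}"
    using assms by (rule has_integral_powr_to_inf)
  hence "(\<lambda>x. x powr e) absolutely_integrable_on {a..}"
    by (intro nonnegative_absolutely_integrable_1) (auto simp: integrable_on_def)
  hence "integrable lebesgue (\<lambda>x. indicator {a..} x * x powr e)"
    by (simp add: set_integrable_def)
  thus ?thesis by (subst (asm) integrable_completion) auto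
qed

text \<open>
  Since \<open>(\<kappa> + \<bar>x\<bar>)\<^sup>2 \<le> 2 (\<kappa>\<^sup>2 + x\<^sup>2)\<close>, the integrand is dominated by a multiple of
  \<open>(\<kappa> + \<bar>x\<bar>)\<^sup>-\<^sup>2\<^sup>\<beta>\<close>, which is covered by a translated and a reflected copy of the power function
  on the half line \<open>[\<kappa>, \<infinity>)\<close>.
\<close>

lemma integrable_inverse_quadratic_powr:
  fixes \<kappa> \<beta> :: real
  assumes "\<kappa> > 0" "\<beta> > 1 / 2"
  shows "integrable lborel (\<lambda>x. (\<kappa>\<^sup>2 + x\<^sup>2) powr (-\<beta>))"
proof -
  define f where "f x = indicator {\<kappa>..} x * x powr (-2 * \<beta>)" for x :: real
  have f: "integrable lborel f"
    unfolding f_def using assms by (intro integrable_powr_half_line) auto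
  have "integrable lborel (\<lambda>x. f (\<kappa> + 1 * x))" "integrable lborel (\<lambda>x. f (\<kappa> + (-1) * x))"
    using f by (auto simp only: lborel_integrable_real_affine_iff)
  hence int: "integrable lborel (\<lambda>x. 2 powr \<beta> * (f (\<kappa> + x) + f (\<kappa> - x)))" by simp
  show ?thesis
  proof (rule Bochner_Integration.integrable_bound[OF int])
    show "(\<lambda>x. (\<kappa>\<^sup>2 + x\<^sup>2) powr - \<beta>) \<in> borel_measurable lborel" by measurable
    have fnn: "0 \<le> f x" for x by (simp add: f_def)
    have "(\<kappa>\<^sup>2 + x\<^sup>2) powr (-\<beta>) \<le> 2 powr \<beta> * (f (\<kappa> + x) + f (\<kappa> - x))" for x
    proof -
      have "(\<kappa> + \<bar>x\<bar>)\<^sup>2 \<le> 2 * (\<kappa>\<^sup>2 + x\<^sup>2)"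
        using sum_squares_bound[of \<kappa> "\<bar>x\<bar>"] by (simp add: power2_sum)
      hence "(\<kappa>\<^sup>2 + x\<^sup>2) powr (-\<beta>) \<le> ((\<kappa> + \<bar>x\<bar>)\<^sup>2 / 2) powr (-\<beta>)"
        using assms by (intro powr_mono2') auto
      also have "\<dots> = 2 powr \<beta> * (\<kappa> + \<bar>x\<bar>) powr (-2 * \<beta>)"
      proof -
        have "(\<kappa> + \<bar>x\<bar>)\<^sup>2 = (\<kappa> + \<bar>x\<bar>) powr 2" using assms by simp
        hence "((\<kappa> + \<bar>x\<bar>)\<^sup>2) powr (-\<beta>) = (\<kappa> + \<bar>x\<bar>) powr (-2 * \<beta>)" by (simp only: powr_powr) simp
        thus ?thesis using assms by (simp add: powr_divide powr_minus field_simps)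
      qed
      also have "(\<kappa> + \<bar>x\<bar>) powr (-2 * \<beta>) \<le> f (\<kappa> + x) + f (\<kappa> - x)"
        using fnn[of "\<kappa> + x"] fnn[of "\<kappa> - x"] assms
        by (cases "x \<ge> 0") (auto simp: f_def indicator_def)
      finally show ?thesis by simp
    qed
    thus "AE x in lborel. norm ((\<kappa>\<^sup>2 + x\<^sup>2) powr - \<beta>)
        \<le> norm (2 powr \<beta> * (f (\<kappa> + x) + f (\<kappa> - x)))"
      using fnn by (intro always_eventually allI) (simp add: abs_of_nonneg)
  qed
qed

text \<open>
  Each of the \<open>d\<close> numbers \<open>\<kappa>\<^sup>2 + (x \<bullet> b)\<^sup>2\<close> is at most
  \<open>\<kappa>\<^sup>2 + \<bar>x\<bar>\<^sup>2\<close>, so the integrand is dominated by the product over the coordinates of their powers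
  with exponent \<open>-\<alpha>/d\<close>. As \<open>\<alpha>/d > 1/2\<close>, every factor is integrable over the line, and Fubini
  applies.
\<close>

lemma integrable_inverse_quadratic_norm_powr:
  fixes \<kappa> \<alpha> :: real
  assumes "\<kappa> > 0" "\<alpha> > real DIM('a::euclidean_space) / 2"
  shows "integrable lborel (\<lambda>x::'a. (\<kappa>\<^sup>2 + (norm x)\<^sup>2) powr (-\<alpha>))"
proof -
  define \<beta> where "\<beta> = \<alpha> / real DIM('a)"
  have \<beta>: "\<beta> > 1 / 2" using assms by (simp add: \<beta>_def field_simps)
  interpret product_sigma_finite "\<lambda>_::'a. lborel :: real measure"
    by standard
  let ?P = "\<lambda>x::'a. \<Prod>b\<in>Basis. (\<kappa>\<^sup>2 + (x \<bullet> b)\<^sup>2) powr (-\<beta>)"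
  have "integrable (Pi\<^sub>M Basis (\<lambda>_::'a. lborel)) (\<lambda>f. \<Prod>b\<in>Basis. (\<kappa>\<^sup>2 + (f b)\<^sup>2) powr (-\<beta>))"
    using assms \<beta> by (intro product_integrable_prod integrable_inverse_quadratic_powr) auto
  hence int: "integrable lborel ?P"
    unfolding lborel_eq[where 'a='a]
    by (subst integrable_distr_eq) (auto cong: prod.cong)
  show ?thesis
  proof (rule Bochner_Integration.integrable_bound[OF int])
    show "(\<lambda>x::'a. (\<kappa>\<^sup>2 + (norm x)\<^sup>2) powr - \<alpha>) \<in> borel_measurable lborel" by measurable
    have "(\<kappa>\<^sup>2 + (norm x)\<^sup>2) powr (-\<alpha>) \<le> ?P x" for x :: 'a
    proof -
      have "(\<kappa>\<^sup>2 + (norm x)\<^sup>2) powr (-\<alpha>) = (\<Prod>b\<in>(Basis::'a set). (\<kappa>\<^sup>2 + (norm x)\<^sup>2) powr (-\<beta>))"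
      proof -
        have "(\<kappa>\<^sup>2 + (norm x)\<^sup>2) powr (-\<alpha>) = ((\<kappa>\<^sup>2 + (norm x)\<^sup>2) powr (-\<beta>)) powr real DIM('a)"
          by (simp add: \<beta>_def powr_powr)
        also have "\<dots> = ((\<kappa>\<^sup>2 + (norm x)\<^sup>2) powr (-\<beta>)) ^ DIM('a)"
          using assms(1) by (intro powr_realpow) simp
        finally show ?thesis by simp
      qed
      also have "\<dots> \<le> ?P x"
      proof (rule prod_mono, intro conjI powr_mono2')
        fix b :: 'a assume b: "b \<in> Basis"
        show "0 < \<kappa>\<^sup>2 + (x \<bullet> b)\<^sup>2" using assms by (simp add: add_pos_nonneg)
        have "(x \<bullet> b)\<^sup>2 \<le> (norm x)\<^sup>2"
          using Basis_le_norm[OF b, of x] by (metis abs_ge_zero power2_abs power_mono)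
        thus "\<kappa>\<^sup>2 + (x \<bullet> b)\<^sup>2 \<le> \<kappa>\<^sup>2 + (norm x)\<^sup>2" by simp
      qed (use \<beta> in auto)
      finally show ?thesis .
    qed
    thus "AE x in lborel. norm ((\<kappa>\<^sup>2 + (norm x)\<^sup>2) powr - \<alpha>) \<le> norm (?P x)"
      by (intro always_eventually allI) (simp add: abs_of_nonneg prod_nonneg)
  qed
qed

section \<open>The denominators as functions of the frequency\<close>

lemma cov_symbol_eq:
  assumes "\<kappa> > 0"
  shows "cov_symbol \<kappa> \<alpha> K \<xi> = \<kappa> powr (2 * \<alpha>) * binomial_partial_sum \<alpha> K ((norm \<xi> / \<kappa>)\<^sup>2)"
proof -
  have "\<kappa> powr (2 * (\<alpha> - real k)) * norm \<xi> ^ (2 * k) = \<kappa> powr (2 * \<alpha>) * ((norm \<xi> / \<kappa>)\<^sup>2) ^ k" for k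
  proof -
    have "2 * (\<alpha> - real k) = 2 * \<alpha> - real (2 * k)" by simp
    hence "\<kappa> powr (2 * (\<alpha> - real k)) = \<kappa> powr (2 * \<alpha>) / \<kappa> ^ (2 * k)"
      using assms by (simp only: powr_diff powr_realpow)
    thus ?thesis by (simp add: power_mult[symmetric] power_divide)
  qed
  thus ?thesis
    by (simp add: cov_symbol_def binomial_partial_sum_def sum_distrib_left atLeast0AtMost mult_ac)
qed

lemma quadratic_powr_eq:
  fixes \<kappa> \<alpha> r :: real
  assumes "\<kappa> > 0"
  shows "(\<kappa>\<^sup>2 + r\<^sup>2) powr \<alpha> = \<kappa> powr (2 * \<alpha>) * (1 + (r / \<kappa>)\<^sup>2) powr \<alpha>"
proof -
  have "\<kappa>\<^sup>2 + r\<^sup>2 = \<kappa> powr 2 * (1 + (r / \<kappa>)\<^sup>2)"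
    using assms by (simp add: field_simps)
  thus ?thesis using assms by (simp only: powr_mult powr_powr)
qed

lemma cov_symbol_ge:
  assumes "\<kappa> > 0" "\<alpha> > 0" "\<alpha> \<notin> \<int>"
  shows "(\<kappa>\<^sup>2 + (norm \<xi>)\<^sup>2) powr \<alpha> \<le> cov_symbol \<kappa> \<alpha> (trunc_order \<alpha> J) \<xi>"
proof -
  have "\<alpha> gchoose Suc (trunc_order \<alpha> J) \<le> 0"
    using gbinomial_trunc_order_signs[OF assms(2,3), of J] by simp
  thus ?thesis
    unfolding cov_symbol_eq[OF assms(1)] quadratic_powr_eq[OF assms(1)]
    by (intro mult_left_mono powr_le_binomial_partial_sum) auto
qed

text \<open>
  The cut-off to the ball is produced by the failure of the binomial series to converge outside
  it: there the denominators tend to infinity. On the sphere the limit is left open, as it is a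
  null set.
\<close>

lemma inverse_cov_symbol_tendsto:
  assumes "\<kappa> > 0" "\<alpha> > 0" "\<alpha> \<notin> \<int>" "norm \<xi> \<noteq> \<kappa>"
  shows "(\<lambda>J. 1 / cov_symbol \<kappa> \<alpha> (trunc_order \<alpha> J) \<xi>)
           \<longlonglongrightarrow> indicator (cball 0 \<kappa>) \<xi> / (\<kappa>\<^sup>2 + (norm \<xi>)\<^sup>2) powr \<alpha>"
proof (cases "norm \<xi> < \<kappa>")
  case True
  hence "(norm \<xi> / \<kappa>)\<^sup>2 < 1" using assms by (simp add: power_less_one_iff abs_square_less_1)
  from binomial_partial_sum_tendsto_powr[OF _ this, of \<alpha>]
  have "(\<lambda>J. cov_symbol \<kappa> \<alpha> (trunc_order \<alpha> J) \<xi>) \<longlonglongrightarrow> (\<kappa>\<^sup>2 + (norm \<xi>)\<^sup>2) powr \<alpha>"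
    unfolding cov_symbol_eq[OF assms(1)] quadratic_powr_eq[OF assms(1)]
    by (intro tendsto_mult tendsto_const) auto
  moreover have "(\<kappa>\<^sup>2 + (norm \<xi>)\<^sup>2) powr \<alpha> \<noteq> 0"
    using assms(1) by (simp add: add_nonneg_eq_0_iff)
  ultimately show ?thesis using True by (auto intro!: tendsto_divide simp: indicator_def)
next
  case False
  hence "1 < (norm \<xi> / \<kappa>)\<^sup>2" using assms by (simp add: one_less_power)
  from binomial_partial_sum_at_top[OF assms(2,3) this]
  have "filterlim (\<lambda>J. cov_symbol \<kappa> \<alpha> (trunc_order \<alpha> J) \<xi>) at_top sequentially"
    unfolding cov_symbol_eq[OF assms(1)]
    using assms(1) by (intro filterlim_tendsto_pos_mult_at_top[OF tendsto_const]) auto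
  hence "(\<lambda>J. 1 / cov_symbol \<kappa> \<alpha> (trunc_order \<alpha> J) \<xi>) \<longlonglongrightarrow> 0"
    by (intro tendsto_divide_0[OF tendsto_const] filterlim_at_top_imp_at_infinity)
  thus ?thesis using False assms(4) by (simp add: indicator_def)
qed

lemma measurable_cov_symbol [measurable]: "cov_symbol \<kappa> \<alpha> K \<in> borel_measurable borel"
  unfolding cov_symbol_def[abs_def] by measurable

section \<open>Convergence in mean and uniform convergence\<close>

lemma inverse_cov_symbol_L1_tendsto:
  fixes \<kappa> \<alpha> :: real
  assumes "\<kappa> > 0" "\<alpha> > real CARD('n::finite) / 2" "\<alpha> \<notin> \<int>"
  defines "f \<equiv> (\<lambda>J \<xi> :: real ^ 'n. 1 / cov_symbol \<kappa> \<alpha> (trunc_order \<alpha> J) \<xi>)"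
    and "g \<equiv> (\<lambda>\<xi> :: real ^ 'n. indicator (cball 0 \<kappa>) \<xi> / (\<kappa>\<^sup>2 + (norm \<xi>)\<^sup>2) powr \<alpha>)"
  shows "\<And>J. integrable lborel (f J)" "integrable lborel g"
    "(\<lambda>J. LINT \<xi>|lborel. \<bar>f J \<xi> - g \<xi>\<bar>) \<longlonglongrightarrow> 0"
proof -
  have \<alpha>: "\<alpha> > 0"
    using assms(2) by (meson divide_nonneg_pos le_less_trans of_nat_0_le_iff zero_less_numeral)
  define w where "w \<xi> = (\<kappa>\<^sup>2 + (norm \<xi>)\<^sup>2) powr (-\<alpha>)" for \<xi> :: "real ^ 'n"
  have w: "integrable lborel w"
    unfolding w_def using assms(1,2) by (intro integrable_inverse_quadratic_norm_powr) auto
  have pos: "0 < (\<kappa>\<^sup>2 + (norm \<xi>)\<^sup>2) powr \<alpha>" for \<xi> :: "real ^ 'n"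
    using assms(1) by (simp add: add_nonneg_eq_0_iff)
  have f: "0 \<le> f J \<xi>" "f J \<xi> \<le> w \<xi>" for J \<xi>
  proof -
    note le = cov_symbol_ge[OF assms(1) \<alpha> assms(3), of \<xi> J]
    show "0 \<le> f J \<xi>"
      unfolding f_def using le pos[of \<xi>] by (intro divide_nonneg_nonneg) linarith+
    show "f J \<xi> \<le> w \<xi>"
      unfolding f_def w_def powr_minus_divide using le pos[of \<xi>]
      by (intro divide_left_mono mult_pos_pos) linarith+
  qed
  have g: "0 \<le> g \<xi>" "g \<xi> \<le> w \<xi>" for \<xi>
    using pos[of \<xi>] by (auto simp: g_def w_def powr_minus_divide indicator_def)
  have [measurable]: "f J \<in> borel_measurable borel" for J unfolding f_def by measurable
  have [measurable]: "g \<in> borel_measurable borel" unfolding g_def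
    by (intro borel_measurable_divide borel_measurable_indicator) (simp, measurable)
  show "integrable lborel (f J)" for J
    by (rule Bochner_Integration.integrable_bound[OF w])
       (use f in \<open>auto intro!: always_eventually intro: order_trans[OF _ abs_ge_self]\<close>)
  show "integrable lborel g"
    by (rule Bochner_Integration.integrable_bound[OF w])
       (use g in \<open>auto intro!: always_eventually intro: order_trans[OF _ abs_ge_self]\<close>)
  have "(\<lambda>J. LINT \<xi>|lborel. \<bar>f J \<xi> - g \<xi>\<bar>) \<longlonglongrightarrow> (LINT \<xi>|(lborel :: (real ^ 'n) measure). 0)"
  proof (rule integral_dominated_convergence[OF _ _ w])
    have "sphere (0 :: real ^ 'n) \<kappa> \<in> null_sets lborel"
      using negligible_sphere[of "0 :: real ^ 'n" \<kappa>]
      by (auto simp: null_sets_completion_iff negligible_iff_null_sets)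
    hence "AE \<xi> in lborel. \<xi> \<notin> sphere (0 :: real ^ 'n) \<kappa>" by (rule AE_not_in)
    thus "AE \<xi> in lborel. (\<lambda>J. \<bar>f J \<xi> - g \<xi>\<bar>) \<longlonglongrightarrow> 0"
    proof eventually_elim
      case (elim \<xi>)
      hence "(\<lambda>J. f J \<xi>) \<longlonglongrightarrow> g \<xi>"
        unfolding f_def g_def using inverse_cov_symbol_tendsto[OF assms(1) \<alpha> assms(3), of \<xi>] by simp
      thus ?case by (intro tendsto_rabs_zero) (simp add: LIM_zero)
    qed
    show "AE \<xi> in lborel. norm \<bar>f J \<xi> - g \<xi>\<bar> \<le> w \<xi>" for J
    proof (intro always_eventually allI)
      fix \<xi> show "norm \<bar>f J \<xi> - g \<xi>\<bar> \<le> w \<xi>" using f[of J \<xi>] g[of \<xi>] by simp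
    qed
  qed auto
  thus "(\<lambda>J. LINT \<xi>|lborel. \<bar>f J \<xi> - g \<xi>\<bar>) \<longlonglongrightarrow> 0" by simp
qed

text \<open>
  The right-hand side is independent of \<open>z\<close>; this is what makes the convergence uniform.
\<close>

lemma norm_phase_integral_diff_le:
  fixes f g :: "'a::euclidean_space \<Rightarrow> real"
  assumes f: "integrable lborel f" and g: "integrable lborel g"
  defines "e \<equiv> (\<lambda>z \<xi>. exp (- (\<i> * complex_of_real (z \<bullet> \<xi>))))"
  shows "norm ((LINT \<xi>|lborel. e z \<xi> * of_real (f \<xi>)) - (LINT \<xi>|lborel. e z \<xi> * of_real (g \<xi>)))
           \<le> (LINT \<xi>|lborel. \<bar>f \<xi> - g \<xi>\<bar>)"
proof -
  have ne: "norm (e z \<xi>) = 1" for \<xi> by (simp add: e_def)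
  have [measurable]: "e z \<in> borel_measurable borel" unfolding e_def by measurable
  note [measurable] = borel_measurable_integrable[OF f] borel_measurable_integrable[OF g]
  have "integrable lborel (\<lambda>\<xi>. e z \<xi> * of_real (h \<xi>))" if h: "integrable lborel h" for h :: "'a \<Rightarrow> real"
  proof (rule Bochner_Integration.integrable_bound[OF h])
    note [measurable] = borel_measurable_integrable[OF h]
    show "(\<lambda>\<xi>. e z \<xi> * of_real (h \<xi>)) \<in> borel_measurable lborel" by measurable
  qed (simp add: norm_mult ne)
  hence "(LINT \<xi>|lborel. e z \<xi> * of_real (f \<xi>)) - (LINT \<xi>|lborel. e z \<xi> * of_real (g \<xi>))
      = (LINT \<xi>|lborel. e z \<xi> * of_real (f \<xi> - g \<xi>))"
    using f g by (subst Bochner_Integration.integral_diff[symmetric]) (auto simp: algebra_simps)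
  also have "norm \<dots> \<le> (LINT \<xi>|lborel. norm (e z \<xi> * of_real (f \<xi> - g \<xi>)))"
    by (rule integral_norm_bound)
  also have "\<dots> = (LINT \<xi>|lborel. \<bar>f \<xi> - g \<xi>\<bar>)"
    by (simp only: norm_mult ne norm_of_real mult_1)
  finally show ?thesis .
qed

theorem theorem4p3:
  fixes \<sigma> \<kappa> \<alpha> :: real
  assumes "\<sigma>\<^sup>2 > 0" and "\<kappa> > 0"
    and "\<alpha> > real CARD('n::finite) / 2" and "\<alpha> \<notin> \<int>"
  shows "uniform_limit UNIV
           (\<lambda>J (x :: real ^ 'n, y :: real ^ 'n). cov_approx \<sigma> \<kappa> \<alpha> (trunc_order \<alpha> J) x y)
           (\<lambda>(x, y). cov_limit \<sigma> \<kappa> \<alpha> x y)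
           sequentially"
proof -
  define c where "c = \<sigma>\<^sup>2 / (2 * pi) ^ CARD('n)"
  have c: "c \<ge> 0" by (simp add: c_def)
  define f where "f J \<xi> = 1 / cov_symbol \<kappa> \<alpha> (trunc_order \<alpha> J) \<xi>" for J and \<xi> :: "real ^ 'n"
  define g where "g \<xi> = indicator (cball 0 \<kappa>) \<xi> / (\<kappa>\<^sup>2 + (norm \<xi>)\<^sup>2) powr \<alpha>" for \<xi> :: "real ^ 'n"
  define e where "e z \<xi> = exp (- (\<i> * complex_of_real (z \<bullet> \<xi>)))" for z \<xi> :: "real ^ 'n"
  note L1 = inverse_cov_symbol_L1_tendsto[OF assms(2,3,4), folded f_def g_def]
  have approx: "cov_approx \<sigma> \<kappa> \<alpha> (trunc_order \<alpha> J) x y =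
      of_real c * (LINT \<xi>|lborel. e (x - y) \<xi> * of_real (f J \<xi>))" for J and x y :: "real ^ 'n"
    by (simp add: cov_approx_def c_def e_def f_def)
  have limit: "cov_limit \<sigma> \<kappa> \<alpha> x y =
      of_real c * (LINT \<xi>|lborel. e (x - y) \<xi> * of_real (g \<xi>))" for x y :: "real ^ 'n"
    unfolding cov_limit_def set_lebesgue_integral_def c_def[symmetric]
    by (intro arg_cong2[where f = "(*)"] refl Bochner_Integration.integral_cong)
       (auto simp: e_def g_def indicator_def)
  have bound: "dist (cov_approx \<sigma> \<kappa> \<alpha> (trunc_order \<alpha> J) x y) (cov_limit \<sigma> \<kappa> \<alpha> x y)
      \<le> c * (LINT \<xi>|lborel. \<bar>f J \<xi> - g \<xi>\<bar>)" for J and x y :: "real ^ 'n"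
  proof -
    have "dist (cov_approx \<sigma> \<kappa> \<alpha> (trunc_order \<alpha> J) x y) (cov_limit \<sigma> \<kappa> \<alpha> x y) =
      c * norm ((LINT \<xi>|lborel. e (x - y) \<xi> * of_real (f J \<xi>))
        - (LINT \<xi>|lborel. e (x - y) \<xi> * of_real (g \<xi>)))"
      unfolding approx limit dist_norm right_diff_distrib[symmetric] norm_mult
      using c by simp
    also have "\<dots> \<le> c * (LINT \<xi>|lborel. \<bar>f J \<xi> - g \<xi>\<bar>)"
      using c norm_phase_integral_diff_le[OF L1(1) L1(2), of "x - y" J]
      unfolding e_def by (intro mult_left_mono) auto
    finally show ?thesis .
  qed
  have lim: "(\<lambda>J. c * (LINT \<xi>|lborel. \<bar>f J \<xi> - g \<xi>\<bar>)) \<longlonglongrightarrow> 0"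
    using tendsto_mult_right_zero[OF L1(3)] .
  show ?thesis
  proof (rule uniform_limitI)
    fix \<epsilon> :: real assume "\<epsilon> > 0"
    from order_tendstoD(2)[OF lim this]
    show "\<forall>\<^sub>F J in sequentially. \<forall>p\<in>UNIV.
        dist (case p of (x :: real ^ 'n, y :: real ^ 'n) \<Rightarrow> cov_approx \<sigma> \<kappa> \<alpha> (trunc_order \<alpha> J) x y)
          (case p of (x, y) \<Rightarrow> cov_limit \<sigma> \<kappa> \<alpha> x y) < \<epsilon>"
      by eventually_elim (auto intro: le_less_trans[OF bound])
  qed
qed

end
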